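(* Let $(K,|\cdot|)$ be a non-Archimedean valued field, $D$ its ring of integers and $K_0$ its prime field. Let $q\in K_0[X]$ be $q:=2X+1$ if $K_0\ne\mathbb F_2$ and $q:=X^2+X+1$ if $K_0=\mathbb F_2$. If $K$ is a transcendental extension of $K_0$, then there exists $t\in D$ (with $q(t^2)\neq0$) such that the matrices $$A:=\begin{pmatrix}q(t^2)&t\\0&(q(t^2))^{-1}\end{pmatrix},\qquad B:=\begin{pmatrix}q(t^2)&0\\(q(t^2))^{-2}\cdot t&(q(t^2))^{-1}\end{pmatrix}$$ form a basis of a free subgroup $\langle A,B\rangle\le\mathrm{SL}(2,D)$ (free of rank two) that acts without nontrivial fixed points on $K^2\setminus\{\mathbf 0\}$ and, for any $r>0$, on $B[\mathbf 0,r]\setminus\{\mathbf 0\}$ and on $S[\mathbf 0,r]$. Moreover, if the valuation $|\cdot|$ is nontrivial, then for any $\varepsilon\in(0,1]$, $t$ can be chosen so that $A,B\in\mathrm{SL}(2,D,\varepsilon)$.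
   Context: A non-Archimedean valuation on a field $K$ is a function $|\cdot|:K\to[0,\infty)$ with $|x|=0\iff x=0$, $|xy|=|x||y|$, $|x+y|\le\max\{|x|,|y|\}$; it is trivial if all nonzero elements have value $1$ (the trivial valuation is allowed unless excluded). $D=\{x\in K:|x|\le1\}$ is the ring of integers. $K^2$ carries the norm $\|x\|=\max\{|x_1|,|x_2|\}$; $B[\mathbf 0,r]=\{y\in K^2:\|y\|\le r\}$, $S[\mathbf 0,r]=\{y\in K^2:\|y\|=r\}$. For $\varepsilon\in(0,1]$, $\mathrm{SL}(2,D,\varepsilon)$ is the group of matrices $[a_{ij}]\in\mathrm{SL}(2,D)$ with $|a_{ii}-1|<\varepsilon$ for $i=1,2$ and $|a_{ij}|<\varepsilon$ for $i\ne j$. A group acts on a set without nontrivial fixed points if the set is invariant under the group and every point of it has trivial stabilizer. *)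

theory Defs
  imports
    "HOL-Algebra.Generated_Groups"
    "HOL-Algebra.Group_Action"
    "HOL-Algebra.Finite_Extensions"
    "HOL-Algebra.Algebraic_Closure_Type"
    "HOL-Analysis.Determinants"
begin

unbundle no fps_syntax

section \<open>Non-Archimedean valuations\<close>

definition nonarch_valuation :: "('a::field \<Rightarrow> real) \<Rightarrow> bool" where
  "nonarch_valuation v \<longleftrightarrow>
     (\<forall>x. 0 \<le> v x) \<and>
     (\<forall>x. v x = 0 \<longleftrightarrow> x = 0) \<and>
     (\<forall>x y. v (x * y) = v x * v y) \<and>
     (\<forall>x y. v (x + y) \<le> max (v x) (v y))"

definition trivial_valuation :: "('a::field \<Rightarrow> real) \<Rightarrow> bool" where
  "trivial_valuation v \<longleftrightarrow> (\<forall>x. x \<noteq> 0 \<longrightarrow> v x = 1)"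

definition integer_ring :: "('a::field \<Rightarrow> real) \<Rightarrow> 'a set" where
  "integer_ring v = {x. v x \<le> 1}"

definition max_norm :: "('a::field \<Rightarrow> real) \<Rightarrow> 'a ^ 2 \<Rightarrow> real" where
  "max_norm v x = max (v (x $ 1)) (v (x $ 2))"

definition closed_ball :: "('a::field \<Rightarrow> real) \<Rightarrow> real \<Rightarrow> ('a ^ 2) set" where
  "closed_ball v r = {y. max_norm v y \<le> r}"

definition norm_sphere :: "('a::field \<Rightarrow> real) \<Rightarrow> real \<Rightarrow> ('a ^ 2) set" where
  "norm_sphere v r = {y. max_norm v y = r}"


section \<open>The prime field\<close>

definition prime_field :: "'a::field set" where
  "prime_field = \<Inter> {F. subfield F (ring_of_type_algebra :: 'a ring)}"

text \<open>An extension is transcendental if it is not algebraic, that is, if some element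
  of the field is transcendental over the subfield.\<close>

definition transcendental_extension :: "'a::field set \<Rightarrow> bool" where
  "transcendental_extension F \<longleftrightarrow>
     (\<exists>x. ring.transcendental (ring_of_type_algebra :: 'a ring) F x)"

text \<open>The prime field is the field with two elements exactly if it consists of 0 and 1 only.\<close>

definition q_poly :: "'a::field poly" where
  "q_poly = (if (prime_field :: 'a set) = {0, 1} then [:1, 1, 1:] else [:1, 2:])"


section \<open>Special linear groups\<close>

definition SL2 :: "'a::field set \<Rightarrow> ('a ^ 2 ^ 2) monoid" where
  "SL2 R = \<lparr>carrier = {M. (\<forall>i j. M $ i $ j \<in> R) \<and> det M = 1}, monoid.mult = (**), monoid.one = mat 1\<rparr>"

definition SL2_eps :: "('a::field \<Rightarrow> real) \<Rightarrow> real \<Rightarrow> ('a ^ 2 ^ 2) monoid" where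
  "SL2_eps v \<epsilon> = (SL2 (integer_ring v))
     \<lparr>carrier := {M \<in> carrier (SL2 (integer_ring v)).
        (\<forall>i. v (M $ i $ i - 1) < \<epsilon>) \<and> (\<forall>i j. i \<noteq> j \<longrightarrow> v (M $ i $ j) < \<epsilon>)}\<rparr>"

definition mat_A :: "'a::field \<Rightarrow> 'a ^ 2 ^ 2" where
  "mat_A t = (let s = poly q_poly (t\<^sup>2) in
     vector [vector [s, t],
             vector [0, inverse s]])"

definition mat_B :: "'a::field \<Rightarrow> 'a ^ 2 ^ 2" where
  "mat_B t = (let s = poly q_poly (t\<^sup>2) in
     vector [vector [s, 0],
             vector [(inverse s)\<^sup>2 * t, inverse s]])"


section \<open>Free groups\<close>

text \<open>A word over a set of group elements is a list of letters \<open>(x, b)\<close>; the letter stands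
  for \<open>x\<close> if \<open>b\<close> is true and for the inverse of \<open>x\<close> otherwise.
  A word is reduced if no two adjacent letters are formally inverse to each other.\<close>

definition eval_letter :: "('g, 'm) monoid_scheme \<Rightarrow> 'g \<times> bool \<Rightarrow> 'g" where
  "eval_letter G l = (if snd l then fst l else inv\<^bsub>G\<^esub> (fst l))"

definition eval_word :: "('g, 'm) monoid_scheme \<Rightarrow> ('g \<times> bool) list \<Rightarrow> 'g" where
  "eval_word G w = foldr (\<lambda>l g. eval_letter G l \<otimes>\<^bsub>G\<^esub> g) w \<one>\<^bsub>G\<^esub>"

definition reduced_word :: "('g \<times> bool) list \<Rightarrow> bool" where
  "reduced_word w \<longleftrightarrow> successively (\<lambda>l m. \<not> (fst l = fst m \<and> snd l \<noteq> snd m)) w"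

text \<open>A group is free on a subset if each of its elements is the value of a unique
  reduced word over the subset.\<close>

definition free_basis :: "('g, 'm) monoid_scheme \<Rightarrow> 'g set \<Rightarrow> bool" where
  "free_basis G S \<longleftrightarrow> group G \<and> S \<subseteq> carrier G \<and>
     bij_betw (eval_word G) {w. fst ` set w \<subseteq> S \<and> reduced_word w} (carrier G)"


section \<open>Actions without nontrivial fixed points\<close>

text \<open>In the library an action on \<open>E\<close> is a homomorphism into the group of bijections of
  \<open>E\<close>, whose members are undefined outside \<open>E\<close>, hence the restriction.
  In particular, \<open>E\<close> is invariant under the group.\<close>

definition acts_without_fixed_points ::
    "('g, 'm) monoid_scheme \<Rightarrow> ('g \<Rightarrow> 'e \<Rightarrow> 'e) \<Rightarrow> 'e set \<Rightarrow> bool" where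
  "acts_without_fixed_points G \<phi> E \<longleftrightarrow>
     group_action G E (\<lambda>g. restrict (\<phi> g) E) \<and>
     (\<forall>x\<in>E. stabilizer G \<phi> x = {\<one>\<^bsub>G\<^esub>})"


section \<open>The subgroup generated by the two matrices\<close>

definition group_AB :: "('a::field \<Rightarrow> real) \<Rightarrow> 'a \<Rightarrow> ('a ^ 2 ^ 2) monoid" where
  "group_AB v t = (SL2 (integer_ring v))
     \<lparr>carrier := generate (SL2 (integer_ring v)) {mat_A t, mat_B t}\<rparr>"

definition good_parameter :: "('a::field \<Rightarrow> real) \<Rightarrow> 'a \<Rightarrow> bool" where
  "good_parameter v t \<longleftrightarrow>
     poly q_poly (t\<^sup>2) \<noteq> 0 \<and>
     mat_A t \<in> carrier (SL2 (integer_ring v)) \<and>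
     mat_B t \<in> carrier (SL2 (integer_ring v)) \<and>
     subgroup (carrier (group_AB v t)) (SL2 (integer_ring v)) \<and>
     mat_A t \<noteq> mat_B t \<and>
     free_basis (group_AB v t) {mat_A t, mat_B t} \<and>
     acts_without_fixed_points (group_AB v t) (*v) (UNIV - {0}) \<and>
     (\<forall>r>0. acts_without_fixed_points (group_AB v t) (*v) (closed_ball v r - {0}) \<and>
            acts_without_fixed_points (group_AB v t) (*v) (norm_sphere v r))"

end

theory Submission
  imports Defs
begin

text \<open>
  Take \<open>t\<close> transcendental and put \<open>s = q(t\<^sup>2)\<close>. A matrix of determinant 1 fixes a nonzero vector
  only if its trace is 2, so both freeness and the absence of fixed points follow once every
  nonempty reduced word in \<open>A\<close>, \<open>B\<close> is shown to have trace different from 2; by conjugation the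
  word may be taken cyclically reduced. The relevant place is \<open>s = 0\<close>. Conjugated by \<open>diag(s, 1)\<close>
  and multiplied by \<open>s\<close>, the four letters become matrices with entries in \<open>\<int>[t, s]\<close> which at
  \<open>s = 0\<close> have rank one. Specialise \<open>t\<close> to a root \<open>\<alpha>\<close> of \<open>q(X\<^sup>2)\<close> in the algebraic closure. If the
  word \<open>w\<close> has length \<open>n\<close>, then \<open>s\<^sup>n tr w\<close> specialises to a cyclic product of pairings of the row of
  one letter with the column of the next one. Each of them is, up to sign, 1, \<open>\<alpha>\<close> or \<open>\<alpha>\<^sup>2 + 1\<close>, hence
  nonzero (this is what the choice of \<open>q\<close> is for), unless the two letters cancel. But if
  \<open>tr w = 2\<close>, then \<open>s\<^sup>n tr w = 2 s\<^sup>n\<close> specialises to 0.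
\<close>

no_notation fps_nth (infixl "$" 75)

section \<open>Reduced words\<close>

abbreviation words :: "'g set \<Rightarrow> ('g \<times> bool) list set" where
  "words S \<equiv> {w. fst ` set w \<subseteq> S}"

definition inv_letter :: "'g \<times> bool \<Rightarrow> 'g \<times> bool" where
  "inv_letter l = (fst l, \<not> snd l)"

lemma inv_letter_inv_letter [simp]: "inv_letter (inv_letter l) = l"
  by (simp add: inv_letter_def)

lemma fst_inv_letter [simp]: "fst (inv_letter l) = fst l"
  by (simp add: inv_letter_def)

definition inv_word :: "('g \<times> bool) list \<Rightarrow> ('g \<times> bool) list" where
  "inv_word w = rev (map inv_letter w)"

lemma reduced_word_iff: "reduced_word w \<longleftrightarrow> successively (\<lambda>l m. m \<noteq> inv_letter l) w"
proof -
  have "(\<lambda>(l :: 'a \<times> bool) m. \<not> (fst l = fst m \<and> snd l \<noteq> snd m)) = (\<lambda>l m. m \<noteq> inv_letter l)"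
    by (auto simp: inv_letter_def fun_eq_iff prod_eq_iff)
  then show ?thesis
    by (simp only: reduced_word_def)
qed

lemma reduced_word_ConsD: "reduced_word (l # w) \<Longrightarrow> reduced_word w"
  by (auto simp: reduced_word_iff successively_Cons)

lemma reduced_word_inv_word: "reduced_word w \<Longrightarrow> reduced_word (inv_word w)"
  by (auto simp: reduced_word_iff inv_word_def successively_map elim: successively_mono)

section \<open>Values of words in a group and a criterion for freeness\<close>

context group
begin

lemma eval_letter_closed [simp]:
  "fst l \<in> carrier G \<Longrightarrow> eval_letter G l \<in> carrier G"
  by (simp add: eval_letter_def)

lemma eval_letter_inv_letter:
  "fst l \<in> carrier G \<Longrightarrow> eval_letter G (inv_letter l) = inv (eval_letter G l)"
  by (simp add: eval_letter_def inv_letter_def)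

lemma eval_word_Nil [simp]: "eval_word G [] = \<one>"
  by (simp add: eval_word_def)

lemma eval_word_Cons [simp]: "eval_word G (l # w) = eval_letter G l \<otimes> eval_word G w"
  by (simp add: eval_word_def)

lemma eval_word_closed [simp]: "w \<in> words (carrier G) \<Longrightarrow> eval_word G w \<in> carrier G"
  by (induction w) auto

lemma eval_word_append [simp]:
  "w \<in> words (carrier G) \<Longrightarrow> w' \<in> words (carrier G) \<Longrightarrow>
   eval_word G (w @ w') = eval_word G w \<otimes> eval_word G w'"
  by (induction w) (auto simp: m_assoc)

lemma eval_word_inv_word:
  "w \<in> words (carrier G) \<Longrightarrow> eval_word G (inv_word w) = inv (eval_word G w)"
proof (induction w)
  case (Cons l w)
  then have "inv_word w \<in> words (carrier G)"
    by (auto simp: inv_word_def)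
  with Cons show ?case
    by (simp add: inv_word_def eval_letter_inv_letter inv_mult_group)
qed (simp add: inv_word_def)

text \<open>Free reduction from the right: a letter put in front of a reduced word either leaves it
  reduced or cancels against its head, and then the tail that remains is again reduced.\<close>

lemma ex_reduced_word:
  assumes "w \<in> words S" "S \<subseteq> carrier G"
  shows "\<exists>w' \<in> words S. reduced_word w' \<and> eval_word G w' = eval_word G w"
  using assms(1)
proof (induction w)
  case Nil
  then show ?case
    by (intro bexI[of _ "[]"]) (auto simp: reduced_word_def)
next
  case (Cons l w)
  then obtain w' where w': "w' \<in> words S" "reduced_word w'" "eval_word G w' = eval_word G w"
    by auto
  have l: "fst l \<in> S" "fst l \<in> carrier G"
    using Cons.prems assms(2) by auto
  show ?case
  proof (cases "reduced_word (l # w')")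
    case True
    then show ?thesis
      using w' l by (intro bexI[of _ "l # w'"]) auto
  next
    case False
    with w'(2) obtain u where u: "w' = inv_letter l # u"
      by (cases w') (auto simp: reduced_word_iff)
    have "eval_word G u \<in> carrier G"
      using w'(1) u assms(2) by (auto intro!: eval_word_closed)
    then have "eval_word G u = eval_letter G l \<otimes> eval_word G w'"
      using l by (simp add: u eval_letter_inv_letter m_assoc [symmetric])
    moreover have "reduced_word u"
      using w'(2) by (auto simp: u reduced_word_iff successively_Cons)
    ultimately show ?thesis
      using w' u by (intro bexI[of _ u]) auto
  qed
qed

lemma generate_eq_reduced_words:
  assumes "S \<subseteq> carrier G"
  shows "generate G S = eval_word G ` {w \<in> words S. reduced_word w}"
proof
  have "\<exists>w \<in> words S. eval_word G w = g" if "g \<in> generate G S" for g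
    using that
  proof induction
    case one
    then show ?case by (intro bexI[of _ "[]"]) auto
  next
    case (incl h)
    then show ?case
      using assms by (intro bexI[of _ "[(h, True)]"]) (auto simp: eval_letter_def)
  next
    case (inv h)
    then show ?case
      using assms by (intro bexI[of _ "[(h, False)]"]) (auto simp: eval_letter_def)
  next
    case (eng h1 h2)
    then obtain w1 w2 where "w1 \<in> words S" "eval_word G w1 = h1" "w2 \<in> words S" "eval_word G w2 = h2"
      by blast
    then show ?case
      using assms by (intro bexI[of _ "w1 @ w2"]) auto
  qed
  moreover have "eval_word G w \<in> eval_word G ` {w \<in> words S. reduced_word w}" if w: "w \<in> words S" for w
  proof -
    obtain w' where "w' \<in> words S" "reduced_word w'" "eval_word G w = eval_word G w'"
      using ex_reduced_word[OF w assms] by metis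
    then show ?thesis
      by (intro image_eqI[of _ _ w']) auto
  qed
  ultimately show "generate G S \<subseteq> eval_word G ` {w \<in> words S. reduced_word w}"
    by blast
  have "eval_word G w \<in> generate G S" if "w \<in> words S" for w
    using that
  proof (induction w)
    case (Cons l w)
    then show ?case
      by (auto simp: eval_letter_def intro: generate.eng[OF generate.incl] generate.eng[OF generate.inv])
  qed (simp add: generate.one)
  then show "eval_word G ` {w \<in> words S. reduced_word w} \<subseteq> generate G S"
    by auto
qed

text \<open>Strip the common prefix of two reduced words with equal values. If anything is left, the
  inverse of one remainder followed by the other is a nonempty reduced word with value 1.\<close>

lemma inj_on_eval_word:
  assumes S: "S \<subseteq> carrier G"
    and no_rel: "\<And>w. w \<in> words S \<Longrightarrow> reduced_word w \<Longrightarrow> w \<noteq> [] \<Longrightarrow> eval_word G w \<noteq> \<one>"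
  shows "inj_on (eval_word G) {w \<in> words S. reduced_word w}"
proof -
  have "w = w'" if "w \<in> words S" "reduced_word w" "w' \<in> words S" "reduced_word w'"
    "eval_word G w = eval_word G w'" for w w'
    using that
  proof (induction w arbitrary: w')
    case Nil
    then show ?case
      using no_rel[of w'] by auto
  next
    case (Cons l w)
    show ?case
    proof (cases w')
      case Nil
      then show ?thesis
        using no_rel[of "l # w"] Cons.prems by auto
    next
      case w': (Cons m u)
      have lw: "l # w \<in> words (carrier G)" "m # u \<in> words (carrier G)"
        using Cons.prems w' S by auto
      have eq: "eval_word G (l # w) = eval_word G (m # u)"
        using Cons.prems(5) w' by simp
      show ?thesis
      proof (cases "l = m")
        case True
        have "eval_word G w = eval_word G u"
          using eq lw by (simp add: True)
        moreover have "w \<in> words S" "u \<in> words S"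
          using Cons.prems(1,3) by (simp_all add: w')
        moreover have "reduced_word w" "reduced_word u"
          using Cons.prems(2,4) by (simp_all add: w' reduced_word_ConsD)
        ultimately have "w = u"
          using Cons.IH by blast
        then show ?thesis
          by (simp add: w' True)
      next
        case False
        have inv: "inv_word (l # w) \<in> words (carrier G)"
          using lw(1) by (auto simp: inv_word_def)
        \<comment> \<open>At the junction \<open>inv_letter l\<close> meets \<open>m\<close>; these
          two cancel only if \<open>l = m\<close>.\<close>
        have "reduced_word (inv_word (l # w) @ (m # u))"
          using reduced_word_inv_word[OF Cons.prems(2)] Cons.prems(4) False
          by (simp add: w' reduced_word_iff successively_append_iff inv_word_def)
        moreover have "eval_word G (inv_word (l # w) @ (m # u)) = \<one>"
          unfolding eval_word_append[OF inv lw(2)] eval_word_inv_word[OF lw(1)] eq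
          by (rule l_inv) (rule eval_word_closed[OF lw(2)])
        moreover have "inv_word (l # w) @ (m # u) \<in> words S"
          using Cons.prems(1,3) by (auto simp: inv_word_def w')
        ultimately show ?thesis
          using no_rel by blast
      qed
    qed
  qed
  then show ?thesis
    by (auto intro!: inj_onI)
qed

lemma free_basis_generate:
  assumes S: "S \<subseteq> carrier G"
    and no_rel: "\<And>w. w \<in> words S \<Longrightarrow> reduced_word w \<Longrightarrow> w \<noteq> [] \<Longrightarrow> eval_word G w \<noteq> \<one>"
  shows "free_basis (G\<lparr>carrier := generate G S\<rparr>) S"
proof -
  let ?H = "G\<lparr>carrier := generate G S\<rparr>"
  have sub: "subgroup (generate G S) G"
    using S by (rule generate_is_subgroup)
  have SH: "S \<subseteq> generate G S"
    by (auto intro: generate.incl)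
  \<comment> \<open>Inverses in the generated subgroup agree with those in \<open>G\<close>, so a
    word over \<open>S\<close> has the same value in both.\<close>
  have "eval_letter ?H l = eval_letter G l" if "fst l \<in> S" for l
    using that SH m_inv_consistent[OF sub, of "fst l"] by (auto simp: eval_letter_def)
  then have ev: "eval_word ?H w = eval_word G w" if "w \<in> words S" for w
    using that by (induction w) (auto simp: eval_word_def)
  have "bij_betw (eval_word G) {w \<in> words S. reduced_word w} (generate G S)"
    using inj_on_eval_word[OF assms] generate_eq_reduced_words[OF S] by (simp add: bij_betw_def)
  then have "bij_betw (eval_word ?H) {w. fst ` set w \<subseteq> S \<and> reduced_word w} (generate G S)"
    by (subst bij_betw_cong[where g = "eval_word G"]) (auto simp: ev)
  then show ?thesis
    using subgroup.subgroup_is_group[OF sub group_axioms] SH by (simp add: free_basis_def)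
qed

end

section \<open>Transcendental elements\<close>

text \<open>The coefficients are integers so that one and the same polynomial can be evaluated at
  \<open>t\<close> in the field and at \<alpha> in its algebraic closure.\<close>

definition ipoly :: "int poly \<Rightarrow> 'a::comm_ring_1 \<Rightarrow> 'a" where
  "ipoly p x = poly (map_poly of_int p) x"

lemma ipoly_0 [simp]: "ipoly 0 x = 0"
  by (simp add: ipoly_def)

lemma ipoly_pCons [simp]: "ipoly (pCons c p) x = of_int c + x * ipoly p x"
proof -
  have "map_poly of_int (pCons c p) = pCons (of_int c :: 'a) (map_poly of_int p)"
    by (rule poly_eqI) (simp add: coeff_map_poly coeff_pCons split: nat.splits)
  then show ?thesis
    by (simp add: ipoly_def)
qed

lemma ipoly_1 [simp]: "ipoly 1 x = 1"
  by (simp add: one_pCons)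

lemma ipoly_add [simp]: "ipoly (p + q) x = ipoly p x + ipoly q x"
proof (induction p arbitrary: q)
  case (pCons c p)
  then show ?case
    by (cases q) (simp add: algebra_simps)
qed simp

lemma ipoly_smult [simp]: "ipoly (Polynomial.smult c p) x = of_int c * ipoly p x"
  by (induction p) (simp_all add: algebra_simps)

lemma ipoly_diff [simp]: "ipoly (p - q) x = ipoly p x - ipoly q x"
  using ipoly_add[of "p - q" q x] by simp

lemma ipoly_mult [simp]: "ipoly (p * q) x = ipoly p x * ipoly q x"
  by (induction p) (simp_all add: algebra_simps)

lemma ipoly_power [simp]: "ipoly (p ^ n) x = ipoly p x ^ n"
  by (induction n) simp_all

section \<open>Subfields and the prime field\<close>

abbreviation TR :: "'a::field ring" where "TR \<equiv> ring_of_type_algebra"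

lemma TR_simps [simp]:
  "carrier (TR :: 'a::field ring) = UNIV" "\<one>\<^bsub>TR\<^esub> = (1 :: 'a)" "\<zero>\<^bsub>TR\<^esub> = (0 :: 'a)"
  "x \<otimes>\<^bsub>TR\<^esub> y = x * (y :: 'a)" "x \<oplus>\<^bsub>TR\<^esub> y = x + (y :: 'a)"
  by (simp_all add: ring_of_type_algebra_def)

lemma field_TR: "Ring.field (TR :: 'a::field ring)"
  by (rule field_from_type_algebra)

lemma inv_TR: "(x :: 'a::field) \<noteq> 0 \<Longrightarrow> inv\<^bsub>TR\<^esub> x = inverse x"
proof -
  assume x: "x \<noteq> 0"
  interpret Ring.field "TR :: 'a ring" by (rule field_TR)
  show ?thesis
    using x by (intro comm_inv_char) auto
qed

lemma pow_TR: "(x :: 'a::field) [^]\<^bsub>TR\<^esub> (n::nat) = x ^ n"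
proof -
  interpret Ring.field "TR :: 'a ring" by (rule field_TR)
  show ?thesis
    by (induction n) (simp_all add: mult.commute)
qed

lemma subfieldD:
  assumes "subfield F (TR :: 'a::field ring)"
  shows "0 \<in> F" "1 \<in> F" "x \<in> F \<Longrightarrow> y \<in> F \<Longrightarrow> x + y \<in> F"
    "x \<in> F \<Longrightarrow> y \<in> F \<Longrightarrow> x * y \<in> F" "x \<in> F \<Longrightarrow> - x \<in> F" "x \<in> F \<Longrightarrow> inverse x \<in> F"
proof -
  interpret Ring.field "TR :: 'a ring" by (rule field_TR)
  note sr = subfieldE(1)[OF assms]
  show 0: "0 \<in> F" and "1 \<in> F" and add: "x \<in> F \<Longrightarrow> y \<in> F \<Longrightarrow> x + y \<in> F"
    and "x \<in> F \<Longrightarrow> y \<in> F \<Longrightarrow> x * y \<in> F"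
    using subringE(2,3,6,7)[OF sr] by auto
  have "\<ominus>\<^bsub>TR\<^esub> x = - x" for x :: 'a
    by (rule minus_equality) auto
  then show "x \<in> F \<Longrightarrow> - x \<in> F"
    using subringE(5)[OF sr] by auto
  show "x \<in> F \<Longrightarrow> inverse x \<in> F"
    using subfield_m_inv(1)[OF assms, of x] 0 by (cases "x = 0") (auto simp: inv_TR)
qed

lemma subfieldI_TR:
  fixes F :: "'a::field set"
  assumes "1 \<in> F" "\<And>x y. x \<in> F \<Longrightarrow> y \<in> F \<Longrightarrow> x + y \<in> F"
    "\<And>x y. x \<in> F \<Longrightarrow> y \<in> F \<Longrightarrow> x * y \<in> F" "\<And>x. x \<in> F \<Longrightarrow> - x \<in> F"
    "\<And>x. x \<in> F \<Longrightarrow> x \<noteq> 0 \<Longrightarrow> inverse x \<in> F"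
  shows "subfield F TR"
proof -
  interpret Ring.field "TR :: 'a ring" by (rule field_TR)
  have um: "\<ominus>\<^bsub>TR\<^esub> x = - x" for x :: 'a
    by (rule minus_equality) auto
  show ?thesis
    by (rule subfieldI'[OF subringI]) (use assms in \<open>auto simp: um inv_TR\<close>)
qed

lemma subfield_prime_field: "subfield (prime_field :: 'a::field set) TR"
  by (rule subfieldI_TR) (auto simp: prime_field_def intro: subfieldD)

lemma of_int_in_subfield:
  assumes "subfield F (TR :: 'a::field ring)"
  shows "of_int k \<in> F"
proof -
  have "of_nat n \<in> F" for n
    by (induction n) (auto intro: subfieldD[OF assms])
  then show ?thesis
    by (cases k rule: int_cases2) (auto intro: subfieldD[OF assms])
qed

text \<open>Ensures that the case \<open>[:1, 2:]\<close> of \<open>q_poly\<close> arises only in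
  characteristic different from 2.\<close>

lemma prime_field_eq_01:
  assumes "(2 :: 'a::field) = 0"
  shows "(prime_field :: 'a set) = {0, 1}"
proof
  have "- 1 = (1 :: 'a)"
    using assms by (metis add_eq_0_iff one_add_one)
  moreover have "1 + 1 = (0 :: 'a)"
    using assms by simp
  ultimately have "subfield {0, 1 :: 'a} TR"
    by (intro subfieldI_TR) auto
  then show "prime_field \<subseteq> {0, 1 :: 'a}"
    by (auto simp: prime_field_def)
  show "{0, 1 :: 'a} \<subseteq> prime_field"
    using subfieldD(1,2)[OF subfield_prime_field] by auto
qed

section \<open>Transcendence over the prime field\<close>

abbreviation transc :: "'a::field \<Rightarrow> bool" where
  "transc x \<equiv> ring.transcendental TR prime_field x"

text \<open>\<open>ring.eval\<close> reads coefficient lists from the leading coefficient down,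
  \<open>Poly\<close> from the constant term up; hence the reversal.\<close>

lemma eval_TR: "ring.eval TR xs (x :: 'a::field) = poly (Poly (rev xs)) x"
proof -
  interpret Ring.field "TR :: 'a ring" by (rule field_TR)
  show ?thesis
    by (induction xs) (simp_all add: pow_TR Poly_append poly_monom mult.commute)
qed

text \<open>The coefficients of \<open>p\<close> land in the prime field, so transcendence applies.
  Only the image of \<open>p\<close> has to vanish: in positive characteristic \<open>p\<close> may
  be nonzero with all coefficients multiples of the characteristic.\<close>

lemma transc_ipoly_coeffs:
  assumes "transc (t :: 'a::field)" "ipoly p t = 0"
  shows "map_poly of_int p = (0 :: 'a poly)"
proof -
  interpret Ring.field "TR :: 'a ring" by (rule field_TR)
  define P where "P = rev (coeffs (map_poly of_int p :: 'a poly))"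
  have "set P \<subseteq> prime_field"
  proof
    fix c assume "c \<in> set P"
    then obtain n where "c = poly.coeff (map_poly of_int p) n"
      using range_coeff[of "map_poly of_int p :: 'a poly"] by (auto simp: P_def)
    then show "c \<in> prime_field"
      by (simp add: coeff_map_poly of_int_in_subfield[OF subfield_prime_field])
  qed
  then have "P \<in> carrier (prime_field [X]\<^bsub>TR\<^esub>)"
    by (auto simp: univ_poly_def polynomial_def P_def hd_rev last_coeffs_eq_coeff_degree)
  moreover have "eval P t = \<zero>\<^bsub>TR\<^esub>"
    using assms(2) by (simp add: eval_TR P_def ipoly_def)
  moreover have "(transcendental over prime_field) t"
    using assms(1) by (simp add: over_def)
  ultimately have "P = []"
    by (intro eval_transcendental)
  then show ?thesis
    by (simp add: P_def)
qed

text \<open>An integer that vanishes in the field also vanishes in its algebraic closure. Hence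
  sending \<open>t\<close> to an arbitrary \<alpha> is well defined on the values of integer
  polynomials.\<close>

lemma transc_specialise:
  assumes "transc (t :: 'a::field)" "ipoly p t = 0"
  shows "ipoly p (\<alpha> :: 'a alg_closure) = 0"
proof -
  have "map_poly of_int p = (0 :: 'a alg_closure poly)"
  proof (rule poly_eqI)
    fix n
    have "of_int (poly.coeff p n) = (0 :: 'a)"
      using transc_ipoly_coeffs[OF assms] by (metis coeff_0 coeff_map_poly of_int_0)
    then show "poly.coeff (map_poly of_int p) n = poly.coeff (0 :: 'a alg_closure poly) n"
      by (metis coeff_0 coeff_map_poly of_int_0 to_ac_0 to_ac_of_int)
  qed
  then show ?thesis
    by (simp add: ipoly_def)
qed

lemma subfield_algebraic: "subfield {x :: 'a::field. \<not> transc x} TR"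
proof -
  interpret Ring.field "TR :: 'a ring" by (rule field_TR)
  show ?thesis
    using subfield_of_algebraics[OF subfield_prime_field] by (simp add: over_def)
qed

section \<open>Valuations and transcendental elements of small value\<close>

lemma nonarch_valuationD:
  fixes v :: "'a::field \<Rightarrow> real"
  assumes "nonarch_valuation v"
  shows "0 \<le> v x" "v x = 0 \<longleftrightarrow> x = 0" "v (x * y) = v x * v y" "v (x + y) \<le> max (v x) (v y)"
    "v 1 = 1" "v (x ^ n) = v x ^ n" "v (inverse x) = inverse (v x)" "v (- x) = v x"
proof -
  show *: "0 \<le> v x" "v x = 0 \<longleftrightarrow> x = 0" "v (x * y) = v x * v y" "v (x + y) \<le> max (v x) (v y)" for x y
    using assms by (auto simp: nonarch_valuation_def)
  show 1: "v 1 = 1"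
    using *(3)[of 1 1] *(2)[of 1] by simp
  show "v (x ^ n) = v x ^ n"
    by (induction n) (simp_all add: 1 *)
  show "v (inverse x) = inverse (v x)"
    using *(3)[of x "inverse x"] *(2)[of x] *(2)[of 0] 1 by (cases "x = 0") (auto simp: inverse_unique)
  have "v (- 1) * v (- 1) = 1"
    using *(3)[of "-1" "-1"] 1 by simp
  then have "v (- 1) = 1"
    using *(1)[of "-1"] by (metis abs_of_nonneg real_sqrt_abs2 real_sqrt_one)
  then show "v (- x) = v x"
    using *(3)[of "-1" x] by simp
qed

text \<open>Some nonzero \<open>c\<close> has value below 1, and \<open>x\<close> or its inverse is
  a transcendental \<open>y\<close> of value at most 1. The algebraic elements form a subfield, so
  \<open>c ^ n\<close> and \<open>y * c ^ n\<close> are not both algebraic; for suitable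
  \<open>n\<close> both have value below \<delta>.\<close>

lemma ex_small_transc:
  fixes v :: "'a::field \<Rightarrow> real"
  assumes v: "nonarch_valuation v" and nt: "\<not> trivial_valuation v"
    and x: "transc (x :: 'a)" and "\<delta> > 0"
  obtains t where "transc t" "v t < \<delta>"
proof -
  note E = subfieldD[OF subfield_algebraic, unfolded mem_Collect_eq]
  note V = nonarch_valuationD[OF v]
  obtain c where c: "v c < 1" "c \<noteq> 0"
  proof -
    obtain c where "c \<noteq> 0" "v c \<noteq> 1"
      using nt by (auto simp: trivial_valuation_def)
    then show ?thesis
      using that[of c] that[of "inverse c"] one_less_inverse_iff[of "inverse (v c)"]
      by (cases "v c < 1") (auto simp: V less_le inverse_le_1_iff)
  qed
  obtain y where y: "transc y" "v y \<le> 1"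
  proof (cases "v x \<le> 1")
    case False
    moreover have "transc (inverse x)"
      using E(6)[of "inverse x"] x by auto
    ultimately show ?thesis
      using that[of "inverse x"] by (simp add: V inverse_le_1_iff)
  qed (use x that in blast)
  obtain n where n: "v c ^ n < \<delta>"
    using real_arch_pow_inv[OF \<open>\<delta> > 0\<close> c(1)] by blast
  show ?thesis
  proof (cases "transc (c ^ n)")
    case True
    then show ?thesis
      using that n by (simp add: V)
  next
    case False
    have "transc (y * c ^ n)"
    proof (rule ccontr)
      assume "\<not> transc (y * c ^ n)"
      then have "\<not> transc (y * c ^ n * inverse (c ^ n))"
        using E(4)[of "y * c ^ n" "inverse (c ^ n)"] E(6)[OF False] by blast
      then show False
        using y c by (simp add: mult.assoc)
    qed
    moreover have "v (y * c ^ n) < \<delta>"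
      using mult_right_mono[OF y(2), of "v c ^ n"] n V(1)[of c] by (simp add: V)
    ultimately show ?thesis
      using that by blast
  qed
qed

section \<open>Words in two-by-two matrices\<close>

definition mat2 :: "'b::zero \<Rightarrow> 'b \<Rightarrow> 'b \<Rightarrow> 'b \<Rightarrow> 'b ^ 2 ^ 2" where
  "mat2 a b c d = vector [vector [a, b], vector [c, d]]"

lemma mat2_nth [simp]:
  "mat2 a b c d $ 1 $ 1 = a" "mat2 a b c d $ 1 $ 2 = b"
  "mat2 a b c d $ 2 $ 1 = c" "mat2 a b c d $ 2 $ 2 = d"
  by (simp_all add: mat2_def)

lemma mat2_eqI:
  "M $ 1 $ 1 = a \<Longrightarrow> M $ 1 $ 2 = b \<Longrightarrow> M $ 2 $ 1 = c \<Longrightarrow> M $ 2 $ 2 = d \<Longrightarrow> M = mat2 a b c d"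
  by (simp add: vec_eq_iff forall_2)

lemma matrix_mult_nth2: "(M ** N) $ i $ j = M $ i $ 1 * N $ 1 $ j + M $ i $ 2 * N $ 2 $ j"
  for M :: "'b::comm_ring_1 ^ 2 ^ 2"
  by (simp add: matrix_matrix_mult_def sum_2)

lemma mat2_mult:
  "mat2 a b c d ** mat2 a' b' c' d' =
   mat2 (a * a' + b * c') (a * b' + b * d') (c * a' + d * c') (c * b' + d * d')"
  for a :: "'b::comm_ring_1"
  by (rule mat2_eqI) (simp_all add: matrix_mult_nth2)

lemma mat_1_eq_mat2: "mat 1 = mat2 1 0 0 (1 :: 'b::comm_ring_1)"
  by (rule mat2_eqI) (simp_all add: mat_def)

lemma trace_2: "trace (M :: 'b::comm_ring_1 ^ 2 ^ 2) = M $ 1 $ 1 + M $ 2 $ 2"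
  by (simp add: trace_def sum_2)

text \<open>
  In a letter \<open>(i, b)\<close>, \<open>i\<close> selects \<open>A\<close> or \<open>B\<close> and \<open>b\<close> the exponent 1 or -1. The integral letter is
  \<open>s\<close> times the conjugate of the letter by \<open>diag(s, 1)\<close>.
\<close>

fun int_letter :: "'b::comm_ring_1 \<Rightarrow> 'b \<Rightarrow> bool \<times> bool \<Rightarrow> 'b ^ 2 ^ 2" where
  "int_letter t s (True, True) = mat2 (s\<^sup>2) t 0 1"
| "int_letter t s (True, False) = mat2 1 (- t) 0 (s\<^sup>2)"
| "int_letter t s (False, True) = mat2 (s\<^sup>2) 0 t 1"
| "int_letter t s (False, False) = mat2 1 0 (- t) (s\<^sup>2)"

fun AB_letter :: "'b::field \<Rightarrow> 'b \<Rightarrow> bool \<times> bool \<Rightarrow> 'b ^ 2 ^ 2" where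
  "AB_letter t s (True, True) = mat2 s t 0 (inverse s)"
| "AB_letter t s (True, False) = mat2 (inverse s) (- t) 0 s"
| "AB_letter t s (False, True) = mat2 s 0 ((inverse s)\<^sup>2 * t) (inverse s)"
| "AB_letter t s (False, False) = mat2 (inverse s) 0 (- ((inverse s)\<^sup>2 * t)) s"

definition word_mat :: "(bool \<times> bool \<Rightarrow> 'b ^ 2 ^ 2) \<Rightarrow> (bool \<times> bool) list \<Rightarrow> 'b::comm_ring_1 ^ 2 ^ 2" where
  "word_mat f w = foldr (\<lambda>l M. f l ** M) w (mat 1)"

lemma word_mat_simps [simp]:
  "word_mat f [] = mat 1" "word_mat f (l # w) = f l ** word_mat f w"
  by (simp_all add: word_mat_def)

lemma word_mat_append: "word_mat f (w @ w') = word_mat f w ** word_mat f w'"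
  by (induction w) (simp_all add: matrix_mul_assoc)

text \<open>
  The relation \<open>k M = D N D\<^sup>-\<^sup>1\<close> for \<open>D = diag(s, 1)\<close>, with the inverse cleared entrywise.
\<close>

definition scaled_conj :: "'b::comm_ring_1 \<Rightarrow> 'b \<Rightarrow> 'b ^ 2 ^ 2 \<Rightarrow> 'b ^ 2 ^ 2 \<Rightarrow> bool" where
  "scaled_conj s k M N \<longleftrightarrow>
     N $ 1 $ 1 = k * M $ 1 $ 1 \<and> s * N $ 1 $ 2 = k * M $ 1 $ 2 \<and>
     N $ 2 $ 1 = s * k * M $ 2 $ 1 \<and> N $ 2 $ 2 = k * M $ 2 $ 2"

text \<open>Conjugation is multiplicative and scalars commute. With inverses cleared this is checked
  summand by summand: each \<open>N $ 1 $ 2\<close> is paired with a factor \<open>s\<close>, either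
  the one in front or the one supplied by an entry in position (2, 1).\<close>

lemma scaled_conj_mult:
  assumes "scaled_conj s k M N" "scaled_conj s k' M' N'"
  shows "scaled_conj s (k * k') (M ** M') (N ** N')"
proof -
  have 1: "N $ 1 $ 1 = k * M $ 1 $ 1" "s * N $ 1 $ 2 = k * M $ 1 $ 2"
    "N $ 2 $ 1 = s * k * M $ 2 $ 1" "N $ 2 $ 2 = k * M $ 2 $ 2"
    and 2: "N' $ 1 $ 1 = k' * M' $ 1 $ 1" "s * N' $ 1 $ 2 = k' * M' $ 1 $ 2"
    "N' $ 2 $ 1 = s * k' * M' $ 2 $ 1" "N' $ 2 $ 2 = k' * M' $ 2 $ 2"
    using assms unfolding scaled_conj_def by blast+
  have p11: "N $ 1 $ 1 * N' $ 1 $ 1 = k * k' * (M $ 1 $ 1 * M' $ 1 $ 1)"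
    unfolding 1(1) 2(1) by (simp only: mult_ac)
  have "N $ 1 $ 2 * N' $ 2 $ 1 = (s * N $ 1 $ 2) * (k' * M' $ 2 $ 1)"
    unfolding 2(3) by (simp only: mult_ac)
  then have p12: "N $ 1 $ 2 * N' $ 2 $ 1 = k * k' * (M $ 1 $ 2 * M' $ 2 $ 1)"
    unfolding 1(2) by (simp only: mult_ac)
  have "s * (N $ 1 $ 1 * N' $ 1 $ 2) = N $ 1 $ 1 * (s * N' $ 1 $ 2)"
    by (simp only: mult_ac)
  then have p13: "s * (N $ 1 $ 1 * N' $ 1 $ 2) = k * k' * (M $ 1 $ 1 * M' $ 1 $ 2)"
    unfolding 1(1) 2(2) by (simp only: mult_ac)
  have "s * (N $ 1 $ 2 * N' $ 2 $ 2) = (s * N $ 1 $ 2) * N' $ 2 $ 2"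
    by (simp only: mult_ac)
  then have p14: "s * (N $ 1 $ 2 * N' $ 2 $ 2) = k * k' * (M $ 1 $ 2 * M' $ 2 $ 2)"
    unfolding 1(2) 2(4) by (simp only: mult_ac)
  have "N $ 2 $ 1 * N' $ 1 $ 2 = k * M $ 2 $ 1 * (s * N' $ 1 $ 2)"
    unfolding 1(3) by (simp only: mult_ac)
  then have p21: "N $ 2 $ 1 * N' $ 1 $ 2 = k * k' * (M $ 2 $ 1 * M' $ 1 $ 2)"
    unfolding 2(2) by (simp only: mult_ac)
  have p22: "N $ 2 $ 2 * N' $ 2 $ 2 = k * k' * (M $ 2 $ 2 * M' $ 2 $ 2)"
    unfolding 1(4) 2(4) by (simp only: mult_ac)
  have p23: "N $ 2 $ 1 * N' $ 1 $ 1 = s * (k * k') * (M $ 2 $ 1 * M' $ 1 $ 1)"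
    unfolding 1(3) 2(1) by (simp only: mult_ac)
  have p24: "N $ 2 $ 2 * N' $ 2 $ 1 = s * (k * k') * (M $ 2 $ 2 * M' $ 2 $ 1)"
    unfolding 1(4) 2(3) by (simp only: mult_ac)
  show ?thesis
    unfolding scaled_conj_def matrix_mult_nth2 distrib_left p11 p12 p13 p14 p21 p22 p23 p24
    by simp
qed

lemma scaled_conj_letter:
  "s \<noteq> 0 \<Longrightarrow> scaled_conj s s (AB_letter t s l) (int_letter t s l)"
  by (cases "(t, s, l)" rule: int_letter.cases)
     (simp_all add: scaled_conj_def power2_eq_square field_simps)

text \<open>In particular the diagonal entries, and with them the trace, only pick up the factor
  \<open>s ^ length w\<close>.\<close>

lemma scaled_conj_word:
  assumes "s \<noteq> 0"
  shows "scaled_conj s (s ^ length w) (word_mat (AB_letter t s) w) (word_mat (int_letter t s) w)"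
proof (induction w)
  case (Cons l w)
  then show ?case
    using scaled_conj_mult[OF scaled_conj_letter[OF assms, of t l]] by simp
qed (simp add: scaled_conj_def mat_1_eq_mat2)

text \<open>\<open>col_vec\<close> and \<open>row_vec\<close> are the two factors of the rank-one
  matrix that a letter becomes at \<open>s = 0\<close>; see \<open>int_letter_0\<close>.\<close>

fun col_vec :: "'b::comm_ring_1 \<Rightarrow> bool \<times> bool \<Rightarrow> 'b \<times> 'b" where
  "col_vec a (True, True) = (a, 1)"
| "col_vec a (True, False) = (1, 0)"
| "col_vec a (False, True) = (0, 1)"
| "col_vec a (False, False) = (1, - a)"

fun row_vec :: "'b::comm_ring_1 \<Rightarrow> bool \<times> bool \<Rightarrow> 'b \<times> 'b" where
  "row_vec a (True, True) = (0, 1)"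
| "row_vec a (True, False) = (1, - a)"
| "row_vec a (False, True) = (a, 1)"
| "row_vec a (False, False) = (1, 0)"

definition outer :: "'b::comm_ring_1 \<Rightarrow> 'b \<times> 'b \<Rightarrow> 'b \<times> 'b \<Rightarrow> 'b ^ 2 ^ 2" where
  "outer c x y = mat2 (c * fst x * fst y) (c * fst x * snd y) (c * snd x * fst y) (c * snd x * snd y)"

definition dot :: "'b::comm_ring_1 \<times> 'b \<Rightarrow> 'b \<times> 'b \<Rightarrow> 'b" where
  "dot x y = fst x * fst y + snd x * snd y"

lemma outer_mult: "outer c x y ** outer c' x' y' = outer (c * c' * dot y x') x y'"
  by (simp add: outer_def dot_def mat2_mult algebra_simps)

lemma trace_outer: "trace (outer c x y) = c * dot y x"
  by (simp add: trace_2 outer_def dot_def algebra_simps)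

lemma int_letter_0: "int_letter a 0 l = outer 1 (col_vec a l) (row_vec a l)"
  by (cases "(a, a, l)" rule: int_letter.cases) (simp_all add: outer_def)

text \<open>Of the sixteen pairs of letters, the four cancelling ones give 0. The value
  \<open>a\<^sup>2 + 1\<close> comes from B followed by A and from the inverse of A followed by that
  of B; the others give 1 or, up to sign, \<open>a\<close>.\<close>

lemma dot_row_col_neq_0:
  fixes a :: "'b::idom"
  assumes "a \<noteq> 0" "a\<^sup>2 + 1 \<noteq> 0" "m \<noteq> inv_letter l"
  shows "dot (row_vec a l) (col_vec a m) \<noteq> 0"
proof -
  have "a * a + 1 \<noteq> 0" "1 + a * a \<noteq> 0"
    using assms(2) by (simp_all add: power2_eq_square add.commute)
  then show ?thesis
    using assms(1,3)
    by (cases "(a, a, l)" rule: int_letter.cases; cases "(a, a, m)" rule: int_letter.cases)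
       (auto simp: dot_def inv_letter_def)
qed

text \<open>A product of rank-one matrices keeps the first column and the last row. The scalar
  collects the pairings of adjacent letters, which are nonzero in a reduced word, and a domain has
  no zero divisors.\<close>

lemma word_mat_int_letter_0:
  fixes a :: "'b::idom"
  assumes a: "a \<noteq> 0" "a\<^sup>2 + 1 \<noteq> 0" and "reduced_word w" "w \<noteq> []"
  shows "\<exists>c. c \<noteq> 0 \<and> word_mat (int_letter a 0) w = outer c (col_vec a (hd w)) (row_vec a (last w))"
  using assms(3,4)
proof (induction w)
  case (Cons l w)
  show ?case
  proof (cases "w = []")
    case True
    then show ?thesis
      by (intro exI[of _ 1]) (simp add: int_letter_0)
  next
    case False
    then obtain c where c: "c \<noteq> 0"
      "word_mat (int_letter a 0) w = outer c (col_vec a (hd w)) (row_vec a (last w))"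
      using Cons reduced_word_ConsD by blast
    have "hd w \<noteq> inv_letter l"
      using Cons.prems(1) False by (simp add: reduced_word_iff successively_Cons)
    then have "dot (row_vec a l) (col_vec a (hd w)) \<noteq> 0"
      using a by (intro dot_row_col_neq_0)
    then show ?thesis
      using c False
      by (intro exI[of _ "c * dot (row_vec a l) (col_vec a (hd w))"])
         (simp add: int_letter_0[of a l] outer_mult)
  qed
qed simp

section \<open>Specialisation at a root of the polynomial\<close>

text \<open>The evaluation map from integer polynomial expressions in \<open>t\<close> to those in
  \<alpha>, given by its graph. As a relation it respects ring operations for every
  \<open>t\<close>; transcendence is needed only to make it single-valued.\<close>

definition specialises :: "'a::field \<Rightarrow> 'a alg_closure \<Rightarrow> 'a \<Rightarrow> 'a alg_closure \<Rightarrow> bool" where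
  "specialises t \<alpha> x y \<longleftrightarrow> (\<exists>p. x = ipoly p t \<and> y = ipoly p \<alpha>)"

lemma specialises_add: "specialises t \<alpha> x y \<Longrightarrow> specialises t \<alpha> x' y' \<Longrightarrow> specialises t \<alpha> (x + x') (y + y')"
  unfolding specialises_def by (metis ipoly_add)

lemma specialises_diff: "specialises t \<alpha> x y \<Longrightarrow> specialises t \<alpha> x' y' \<Longrightarrow> specialises t \<alpha> (x - x') (y - y')"
  unfolding specialises_def by (metis ipoly_diff)

lemma specialises_mult: "specialises t \<alpha> x y \<Longrightarrow> specialises t \<alpha> x' y' \<Longrightarrow> specialises t \<alpha> (x * x') (y * y')"
  unfolding specialises_def by (metis ipoly_mult)

lemma specialises_power: "specialises t \<alpha> x y \<Longrightarrow> specialises t \<alpha> (x ^ n) (y ^ n)"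
  unfolding specialises_def by (metis ipoly_power)

lemma specialises_of_int: "specialises t \<alpha> (of_int k) (of_int k)"
  unfolding specialises_def by (intro exI[of _ "[:k:]"]) simp

lemma specialises_self: "specialises t \<alpha> t \<alpha>"
  unfolding specialises_def by (intro exI[of _ "[:0, 1:]"]) simp

lemma specialises_consts:
  "specialises t \<alpha> 0 0" "specialises t \<alpha> 1 1" "specialises t \<alpha> (- t) (- \<alpha>)"
  using specialises_of_int[of t \<alpha> 0] specialises_of_int[of t \<alpha> 1]
    specialises_diff[OF specialises_of_int[of t \<alpha> 0] specialises_self[of t \<alpha>]] by simp_all

lemma specialises_zero: "transc t \<Longrightarrow> specialises t \<alpha> 0 y \<Longrightarrow> y = 0"
  unfolding specialises_def by (metis transc_specialise)

lemma specialises_int_letter: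
  assumes "specialises t \<alpha> s \<sigma>"
  shows "specialises t \<alpha> (int_letter t s l $ i $ j) (int_letter \<alpha> \<sigma> l $ i $ j)"
  using exhaust_2[of i] exhaust_2[of j]
  by (cases "(t, s, l)" rule: int_letter.cases)
     (auto simp: specialises_self specialises_consts specialises_power[OF assms])

lemma specialises_word:
  assumes "specialises t \<alpha> s \<sigma>"
  shows "specialises t \<alpha> (word_mat (int_letter t s) w $ i $ j) (word_mat (int_letter \<alpha> \<sigma>) w $ i $ j)"
proof (induction w arbitrary: i j)
  case Nil
  then show ?case
    by (simp add: mat_def specialises_consts)
next
  case (Cons l w)
  then show ?case
    by (simp add: matrix_mult_nth2 specialises_add specialises_mult specialises_int_letter[OF assms])
qed

text \<open>The condition on \<open>hd w\<close> and \<open>last w\<close> makes the word cyclically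
  reduced; it keeps the pairing that closes the cycle from vanishing.\<close>

lemma trace_cyclically_reduced_word_neq_2:
  fixes t :: "'a::field" and \<alpha> :: "'a alg_closure"
  assumes t: "transc t" and s: "specialises t \<alpha> s 0" "s \<noteq> 0"
    and \<alpha>: "\<alpha> \<noteq> 0" "\<alpha>\<^sup>2 + 1 \<noteq> 0"
    and w: "reduced_word w" "w \<noteq> []" "hd w \<noteq> inv_letter (last w)"
  shows "trace (word_mat (AB_letter t s) w) \<noteq> 2"
proof
  let ?M = "word_mat (AB_letter t s) w"
    and ?N = "word_mat (int_letter t s) w" and ?L = "word_mat (int_letter \<alpha> 0) w"
  assume "trace ?M = 2"
  then have "trace ?N - 2 * s ^ length w = 0"
    using scaled_conj_word[OF s(2), of w t]
    by (simp add: scaled_conj_def trace_2 flip: distrib_left)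
  \<comment> \<open>The left side is 0 by the previous step. On the right the power of 0 disappears
    because \<open>w\<close> is nonempty.\<close>
  moreover have "specialises t \<alpha> (trace ?N - of_int 2 * s ^ length w) (trace ?L - of_int 2 * 0 ^ length w)"
    unfolding trace_2
    by (intro specialises_diff specialises_add specialises_mult specialises_of_int
        specialises_power specialises_word s)
  ultimately have "trace ?L = 0"
    using specialises_zero[OF t] w(2) by (simp add: power_0_left)
  moreover obtain c where "c \<noteq> 0" "?L = outer c (col_vec \<alpha> (hd w)) (row_vec \<alpha> (last w))"
    using word_mat_int_letter_0[OF \<alpha> w(1,2)] by blast
  ultimately show False
    using dot_row_col_neq_0[OF \<alpha> w(3)] by (simp add: trace_outer)
qed

lemma AB_letter_inv: "s \<noteq> 0 \<Longrightarrow> AB_letter t s (inv_letter l) ** AB_letter t s l = mat 1"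
  by (cases "(t, s, l)" rule: int_letter.cases)
     (simp_all add: inv_letter_def mat2_mult mat_1_eq_mat2 power2_eq_square)

text \<open>If the outer letters are inverse to each other, removing them is a conjugation, which
  preserves the trace and shortens the word.\<close>

lemma trace_word_neq_2:
  fixes t :: "'a::field" and \<alpha> :: "'a alg_closure"
  assumes t: "transc t" and s: "specialises t \<alpha> s 0" "s \<noteq> 0"
    and \<alpha>: "\<alpha> \<noteq> 0" "\<alpha>\<^sup>2 + 1 \<noteq> 0"
    and w: "reduced_word w" "w \<noteq> []"
  shows "trace (word_mat (AB_letter t s) w) \<noteq> 2"
  using w
proof (induction "length w" arbitrary: w rule: less_induct)
  case less
  show ?case
  proof (cases "hd w = inv_letter (last w)")
    case False
    then show ?thesis
      using trace_cyclically_reduced_word_neq_2[OF t s \<alpha>] less.prems by blast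
  next
    case True
    obtain m v where v: "w = v @ [m]"
      using less.prems(2) by (metis rev_exhaust)
    \<comment> \<open>A single letter is not its own formal inverse.\<close>
    have "v \<noteq> []"
      using True by (auto simp: v inv_letter_def prod_eq_iff)
    then obtain u where u: "w = inv_letter m # u @ [m]"
      using True v by (cases v) auto
    \<comment> \<open>Otherwise \<open>w\<close> would consist of two cancelling letters.\<close>
    have "u \<noteq> []"
      using less.prems(1) by (auto simp: u reduced_word_iff)
    moreover have "reduced_word u"
      using less.prems(1) by (auto simp: u reduced_word_iff successively_Cons successively_append_iff)
    ultimately have "trace (word_mat (AB_letter t s) u) \<noteq> 2"
      using less.hyps[of u] by (simp add: u)
    moreover have "trace (word_mat (AB_letter t s) w) =
        trace ((AB_letter t s m ** AB_letter t s (inv_letter m)) ** word_mat (AB_letter t s) u)"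
      by (subst matrix_mul_assoc [symmetric], subst trace_mul_sym)
         (simp add: u word_mat_append matrix_mul_assoc)
    moreover have "AB_letter t s m ** AB_letter t s (inv_letter m) = mat 1"
      using AB_letter_inv[OF s(2), of t "inv_letter m"] by simp
    ultimately show ?thesis
      by simp
  qed
qed

section \<open>The action of the special linear group\<close>

lemma integer_ring_closed:
  assumes "nonarch_valuation v"
  shows "0 \<in> integer_ring v" "1 \<in> integer_ring v"
    "x \<in> integer_ring v \<Longrightarrow> y \<in> integer_ring v \<Longrightarrow> x + y \<in> integer_ring v"
    "x \<in> integer_ring v \<Longrightarrow> y \<in> integer_ring v \<Longrightarrow> x * y \<in> integer_ring v"
    "x \<in> integer_ring v \<Longrightarrow> - x \<in> integer_ring v"
proof -
  note V = nonarch_valuationD[OF assms]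
  show "0 \<in> integer_ring v" "1 \<in> integer_ring v"
    using V(2)[of 0] V(5) by (simp_all add: integer_ring_def)
  show "x \<in> integer_ring v \<Longrightarrow> y \<in> integer_ring v \<Longrightarrow> x + y \<in> integer_ring v"
    using V(4)[of x y] by (simp add: integer_ring_def)
  show "x \<in> integer_ring v \<Longrightarrow> y \<in> integer_ring v \<Longrightarrow> x * y \<in> integer_ring v"
    using V(1) by (simp add: integer_ring_def V(3) mult_le_one)
  show "x \<in> integer_ring v \<Longrightarrow> - x \<in> integer_ring v"
    by (simp add: integer_ring_def V(8))
qed

lemma SL2_simps [simp]:
  "M \<otimes>\<^bsub>SL2 R\<^esub> N = M ** N" "\<one>\<^bsub>SL2 R\<^esub> = mat 1"
  "M \<in> carrier (SL2 R) \<longleftrightarrow> (\<forall>i j. M $ i $ j \<in> R) \<and> det M = 1"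
  by (simp_all add: SL2_def)

lemma adj2_mult:
  fixes M :: "'a::comm_ring_1 ^ 2 ^ 2"
  assumes "det M = 1"
  shows "mat2 (M $ 2 $ 2) (- M $ 1 $ 2) (- M $ 2 $ 1) (M $ 1 $ 1) ** M = mat 1"
proof -
  have "M $ 1 $ 1 * M $ 2 $ 2 - M $ 1 $ 2 * M $ 2 $ 1 = 1"
    using assms by (simp add: det_2)
  then show ?thesis
    by (simp add: mat_1_eq_mat2 vec_eq_iff forall_2 matrix_mult_nth2 algebra_simps)
qed

lemma group_SL2:
  assumes v: "nonarch_valuation v"
  shows "group (SL2 (integer_ring v))"
proof (rule groupI)
  note R = integer_ring_closed[OF v]
  show "M \<otimes>\<^bsub>SL2 (integer_ring v)\<^esub> N \<in> carrier (SL2 (integer_ring v))"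
    if "M \<in> carrier (SL2 (integer_ring v))" "N \<in> carrier (SL2 (integer_ring v))" for M N
    using that by (simp add: det_mul matrix_mult_nth2 R)
  show "\<one>\<^bsub>SL2 (integer_ring v)\<^esub> \<in> carrier (SL2 (integer_ring v))"
    using R(1,2) by (simp add: det_I) (simp add: mat_def)
  show "\<exists>N\<in>carrier (SL2 (integer_ring v)). N \<otimes>\<^bsub>SL2 (integer_ring v)\<^esub> M = \<one>\<^bsub>SL2 (integer_ring v)\<^esub>"
    if M: "M \<in> carrier (SL2 (integer_ring v))" for M
  proof
    \<comment> \<open>The adjugate: its entries stay in the ring of integers, and it is the inverse
      since the determinant is 1.\<close>
    let ?N = "mat2 (M $ 2 $ 2) (- M $ 1 $ 2) (- M $ 2 $ 1) (M $ 1 $ 1)"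
    show "?N \<otimes>\<^bsub>SL2 (integer_ring v)\<^esub> M = \<one>\<^bsub>SL2 (integer_ring v)\<^esub>"
      using M by (simp add: adj2_mult)
    have "det ?N = det M"
      by (simp add: det_2 mult.commute)
    then show "?N \<in> carrier (SL2 (integer_ring v))"
      using M by (simp add: forall_2 R)
  qed
qed (simp_all add: matrix_mul_assoc)

lemma inv_SL2:
  assumes v: "nonarch_valuation v"
    and M: "M \<in> carrier (SL2 (integer_ring v))" and N: "N \<in> carrier (SL2 (integer_ring v))"
    and "N ** M = mat 1"
  shows "inv\<^bsub>SL2 (integer_ring v)\<^esub> M = N"
proof -
  interpret group "SL2 (integer_ring v)"
    using v by (rule group_SL2)
  show ?thesis
    using assms by (intro inv_equality) auto
qed

text \<open>For determinant 1, \<open>det (M - 1)\<close> equals 2 minus the trace of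
  \<open>M\<close>, and a nonzero fixed vector makes \<open>M - 1\<close> singular.\<close>

lemma fixed_vector_trace:
  fixes M :: "'a::field ^ 2 ^ 2"
  assumes "det M = 1" "M *v x = x" "x \<noteq> 0"
  shows "trace M = 2"
proof -
  define a b c d where abcd: "a = M $ 1 $ 1" "b = M $ 1 $ 2" "c = M $ 2 $ 1" "d = M $ 2 $ 2"
  have det: "a * d - b * c = 1"
    using assms(1) by (simp add: det_2 abcd)
  have "(M *v x) $ i = M $ i $ 1 * x $ 1 + M $ i $ 2 * x $ 2" for i
    by (simp add: matrix_vector_mult_def sum_2)
  then have x: "a * x $ 1 + b * x $ 2 = x $ 1" "c * x $ 1 + d * x $ 2 = x $ 2"
    using assms(2) by (metis abcd)+
  have "2 - (a + d) = (a * d - b * c) + 1 - (a + d)"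
    by (simp add: det)
  then have 2: "2 - (a + d) = (a - 1) * (d - 1) - b * c"
    by (simp add: algebra_simps)
  \<comment> \<open>This identity and the one for \<open>x $ 2\<close> are the rows of the adjugate
    of \<open>M - 1\<close> applied to \<open>(M - 1) x\<close>, which is 0.\<close>
  have "(2 - (a + d)) * x $ 1 = (d - 1) * (a * x $ 1 + b * x $ 2 - x $ 1) - b * (c * x $ 1 + d * x $ 2 - x $ 2)"
    unfolding 2 by (simp only: algebra_simps mult_1_left mult_1_right)
  then have "(2 - (a + d)) * x $ 1 = 0"
    by (simp add: x)
  moreover have "(2 - (a + d)) * x $ 2 = (a - 1) * (c * x $ 1 + d * x $ 2 - x $ 2) - c * (a * x $ 1 + b * x $ 2 - x $ 1)"
    unfolding 2 by (simp only: algebra_simps mult_1_left mult_1_right)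
  then have "(2 - (a + d)) * x $ 2 = 0"
    by (simp add: x)
  moreover have "x $ 1 \<noteq> 0 \<or> x $ 2 \<noteq> 0"
    using assms(3) by (auto simp: vec_eq_iff forall_2)
  ultimately have "a + d = 2"
    by auto
  then show ?thesis
    by (simp add: trace_2 abcd)
qed

text \<open>Bijectivity comes for free: the inverse group element acts as the inverse map on the
  invariant set \<open>E\<close>.\<close>

lemma group_actionI:
  assumes "group H"
    and inv: "\<And>g x. g \<in> carrier H \<Longrightarrow> x \<in> E \<Longrightarrow> \<phi> g x \<in> E"
    and one: "\<And>x. x \<in> E \<Longrightarrow> \<phi> \<one>\<^bsub>H\<^esub> x = x"
    and mult: "\<And>g h x. g \<in> carrier H \<Longrightarrow> h \<in> carrier H \<Longrightarrow> x \<in> E \<Longrightarrow>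
      \<phi> (g \<otimes>\<^bsub>H\<^esub> h) x = \<phi> g (\<phi> h x)"
  shows "group_action H E (\<lambda>g. restrict (\<phi> g) E)"
proof -
  interpret group H by fact
  have bij: "restrict (\<phi> g) E \<in> Bij E" if g: "g \<in> carrier H" for g
  proof -
    have "bij_betw (\<phi> g) E E"
    proof (rule bij_betwI[where g = "\<phi> (inv\<^bsub>H\<^esub> g)"])
      show "\<phi> (inv\<^bsub>H\<^esub> g) (\<phi> g x) = x" "\<phi> g (\<phi> (inv\<^bsub>H\<^esub> g) x) = x" if "x \<in> E" for x
        using mult[of "inv\<^bsub>H\<^esub> g" g x] mult[of g "inv\<^bsub>H\<^esub> g" x] one[of x] g that by simp_all
    qed (use g inv in auto)
    then have "bij_betw (restrict (\<phi> g) E) E E"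
      by (subst bij_betw_cong[where g = "\<phi> g"]) auto
    then show ?thesis
      by (simp add: Bij_def)
  qed
  have "(\<lambda>g. restrict (\<phi> g) E) \<in> hom H (BijGroup E)"
  proof (rule homI)
    show "restrict (\<phi> g) E \<in> carrier (BijGroup E)" if "g \<in> carrier H" for g
      using bij[OF that] by (simp add: BijGroup_def)
    show "restrict (\<phi> (g \<otimes>\<^bsub>H\<^esub> h)) E = restrict (\<phi> g) E \<otimes>\<^bsub>BijGroup E\<^esub> restrict (\<phi> h) E"
      if "g \<in> carrier H" "h \<in> carrier H" for g h
      using bij that by (auto simp: BijGroup_def compose_def fun_eq_iff inv mult)
  qed
  then show ?thesis
    unfolding group_action_def group_hom_def group_hom_axioms_def
    using group_BijGroup by (simp add: group_axioms)
qed

lemma max_norm_mult_le: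
  assumes v: "nonarch_valuation v" and M: "M \<in> carrier (SL2 (integer_ring v))"
  shows "max_norm v (M *v x) \<le> max_norm v x"
proof -
  note V = nonarch_valuationD[OF v]
  have le: "v (M $ i $ j * x $ j) \<le> v (x $ j)" for i j
    using M mult_right_mono[of "v (M $ i $ j)" 1 "v (x $ j)"] V(1)
    by (simp add: V(3) integer_ring_def)
  have "(M *v x) $ i = M $ i $ 1 * x $ 1 + M $ i $ 2 * x $ 2" for i
    by (simp add: matrix_vector_mult_def sum_2)
  then have "v ((M *v x) $ i) \<le> max (v (x $ 1)) (v (x $ 2))" for i
    using V(4)[of "M $ i $ 1 * x $ 1" "M $ i $ 2 * x $ 2"] le[of i 1] le[of i 2] by simp
  then show ?thesis
    by (simp add: max_norm_def)
qed

text \<open>The ultrametric inequality bounds the norm of the image; applying the same bound to the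
  inverse matrix turns it into an equality.\<close>

lemma max_norm_mult:
  assumes v: "nonarch_valuation v" and M: "M \<in> carrier (SL2 (integer_ring v))"
  shows "max_norm v (M *v x) = max_norm v x"
proof (rule antisym)
  interpret group "SL2 (integer_ring v)"
    using v by (rule group_SL2)
  let ?N = "inv\<^bsub>SL2 (integer_ring v)\<^esub> M"
  have "?N *v (M *v x) = x"
    using l_inv[OF M] by (simp add: matrix_vector_mul_assoc)
  then show "max_norm v x \<le> max_norm v (M *v x)"
    using max_norm_mult_le[OF v inv_closed[OF M], of "M *v x"] by simp
qed (rule max_norm_mult_le[OF v M])

section \<open>Admissible parameters\<close>

text \<open>Here \<open>P\<close> is \<open>q(X\<^sup>2)\<close> with integer coefficients and
  \<alpha> one of its roots. The constant term 1 excludes the root 0, and \<open>q(-1)\<close>,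
  being 1 or -1, excludes a root with square -1.\<close>

lemma q_specialisation:
  fixes t :: "'a::field"
  assumes t: "transc t"
  obtains \<alpha> :: "'a alg_closure"
  where "specialises t \<alpha> (poly q_poly (t\<^sup>2)) 0" "poly q_poly (t\<^sup>2) \<noteq> 0"
    "\<alpha> \<noteq> 0" "\<alpha>\<^sup>2 + 1 \<noteq> 0"
proof -
  obtain P :: "int poly" and \<alpha> :: "'a alg_closure"
    where P: "poly q_poly (t\<^sup>2) = ipoly P t" "ipoly P \<alpha> = 0"
      "ipoly P (0 :: 'a alg_closure) = 1" and \<alpha>: "\<alpha>\<^sup>2 + 1 \<noteq> 0"
  proof (cases "(prime_field :: 'a set) = {0, 1}")
    case True
    have "\<exists>\<alpha> :: 'a alg_closure. poly [:1, 0, 1, 0, 1:] \<alpha> = 0"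
      by (rule alg_closed_imp_poly_has_root) simp
    then obtain \<alpha> :: "'a alg_closure" where \<alpha>: "1 + \<alpha> * (\<alpha> * (1 + \<alpha> * \<alpha>)) = 0"
      by auto
    have "\<alpha>\<^sup>2 + 1 \<noteq> 0"
      using \<alpha> by (auto simp: power2_eq_square add.commute)
    then show ?thesis
      using that[of "[:1, 0, 1, 0, 1:]" \<alpha>] \<alpha> True
      by (simp add: q_poly_def power2_eq_square algebra_simps)
  next
    case False
    then have "(2 :: 'a) \<noteq> 0"
      using prime_field_eq_01 by blast
    \<comment> \<open>Makes \<open>[:1, 0, 2:]\<close> nonconstant, so that it has a root.\<close>
    then have "(2 :: 'a alg_closure) \<noteq> 0"
      by (metis to_ac_numeral to_ac_eq_0_iff)
    then have "\<exists>\<alpha> :: 'a alg_closure. poly [:1, 0, 2:] \<alpha> = 0"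
      by (intro alg_closed_imp_poly_has_root) simp
    then obtain \<alpha> :: "'a alg_closure" where \<alpha>: "1 + \<alpha> * (\<alpha> * 2) = 0"
      by auto
    have "\<alpha>\<^sup>2 + 1 \<noteq> 0"
    proof
      assume "\<alpha>\<^sup>2 + 1 = 0"
      then have "\<alpha> * \<alpha> = - 1"
        by (simp add: power2_eq_square add_eq_0_iff2)
      then have "1 + \<alpha> * (\<alpha> * 2) = - 1"
        by (simp flip: mult.assoc)
      with \<alpha> show False
        by simp
    qed
    then show ?thesis
      using that[of "[:1, 0, 2:]" \<alpha>] \<alpha> False
      by (simp add: q_poly_def power2_eq_square algebra_simps)
  qed
  have "specialises t \<alpha> (poly q_poly (t\<^sup>2)) 0"
    using P unfolding specialises_def by metis
  \<comment> \<open>Specialise \<open>t\<close> to 0 instead of \<alpha>: there \<open>P\<close> has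
    the value 1.\<close>
  moreover have "poly q_poly (t\<^sup>2) \<noteq> 0"
    using transc_specialise[OF t, of P 0] P by auto
  moreover have "\<alpha> \<noteq> 0"
    using P by auto
  ultimately show ?thesis
    using that \<alpha> by blast
qed

lemma mat_AB_eq_AB_letter:
  "mat_A t = AB_letter t (poly q_poly (t\<^sup>2)) (True, True)"
  "mat_B t = AB_letter t (poly q_poly (t\<^sup>2)) (False, True)"
  by (simp_all add: mat_A_def mat_B_def mat2_def Let_def)

text \<open>Value 1 for \<open>q(t\<^sup>2)\<close> puts this element and its inverse into the ring
  of integers, hence all four letters into the special linear group. The rest follows from the
  traces of reduced words.\<close>

lemma good_parameter_transc:
  fixes t :: "'a::field"
  assumes v: "nonarch_valuation v" and t: "transc t" and tv: "v t \<le> 1"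
    and vs: "v (poly q_poly (t\<^sup>2)) = 1"
  shows "good_parameter v t"
proof -
  define s where "s = poly q_poly (t\<^sup>2)"
  define G where "G = SL2 (integer_ring v)"
  define S where "S = {mat_A t, mat_B t}"
  obtain \<alpha> where s: "specialises t \<alpha> s 0" "s \<noteq> 0" and \<alpha>: "\<alpha> \<noteq> 0" "\<alpha>\<^sup>2 + 1 \<noteq> 0"
    using q_specialisation[OF t] unfolding s_def by blast
  note trace_ne = trace_word_neq_2[OF t s \<alpha>]
  interpret G: group G
    unfolding G_def using v by (rule group_SL2)
  have G_simps: "M \<otimes>\<^bsub>G\<^esub> N = M ** N" "\<one>\<^bsub>G\<^esub> = mat 1" for M N
    by (simp_all add: G_def)
  note V = nonarch_valuationD[OF v] and R = integer_ring_closed[OF v]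
  have "t \<in> integer_ring v" "s \<in> integer_ring v" "inverse s \<in> integer_ring v"
    using tv vs by (simp_all add: integer_ring_def V(7) s_def)
  then have letter: "AB_letter t s l \<in> carrier G" for l
    unfolding G_def SL2_simps
    by (cases "(t, s, l)" rule: int_letter.cases)
       (use s(2) in \<open>auto simp: forall_2 det_2 power2_eq_square R\<close>)
  have AB: "mat_A t = AB_letter t s (True, True)" "mat_B t = AB_letter t s (False, True)"
    by (simp_all add: mat_AB_eq_AB_letter s_def)
  have S: "S \<subseteq> carrier G"
    unfolding S_def AB using letter by blast
  \<comment> \<open>0 is algebraic. The entries in position (1, 2), \<open>t\<close> and 0, then
    tell the two matrices apart.\<close>
  have "t \<noteq> 0"
    using subfieldD(1)[OF subfield_algebraic] t by auto
  then have neq: "mat_A t \<noteq> mat_B t"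
    unfolding AB by (metis AB_letter.simps(1,3) mat2_nth(2))
  \<comment> \<open>Translates letters over the two matrices into Boolean letters, with
    \<open>True\<close> for A. It is injective on letters over \<open>S\<close>, so reduced words
    stay reduced.\<close>
  define \<phi> where "\<phi> = (\<lambda>l :: ('a ^ 2 ^ 2) \<times> bool. (fst l = mat_A t, snd l))"
  have "eval_letter G l = AB_letter t s (\<phi> l)" if "fst l \<in> S" for l
  proof -
    have "inv\<^bsub>G\<^esub> (AB_letter t s (i, True)) = AB_letter t s (i, False)" for i
      unfolding G_def
      by (rule inv_SL2[OF v]) (use letter AB_letter_inv[OF s(2), of t "(i, True)"]
        in \<open>simp_all only: G_def inv_letter_def fst_conv snd_conv not_True_eq_False\<close>)
    then show ?thesis
      using that neq
      by (cases l) (auto simp: eval_letter_def \<phi>_def S_def AB simp del: AB_letter.simps)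
  qed
  then have eval: "eval_word G w = word_mat (AB_letter t s) (map \<phi> w)" if "w \<in> words S" for w
    using that by (induction w) (auto simp: G_simps)
  have trace: "trace (eval_word G w) \<noteq> 2" if w: "w \<in> words S" "reduced_word w" "w \<noteq> []" for w
  proof -
    have "successively (\<lambda>l m. \<phi> m \<noteq> inv_letter (\<phi> l)) w"
      using w(2) unfolding reduced_word_iff
    proof (rule successively_mono)
      fix l m assume lm: "l \<in> set w" "m \<in> set w" "m \<noteq> inv_letter l"
      have "fst l \<in> S" "fst m \<in> S"
        using w(1) lm(1,2) by auto
      show "\<phi> m \<noteq> inv_letter (\<phi> l)"
      proof
        assume "\<phi> m = inv_letter (\<phi> l)"
        then have eq: "fst m = mat_A t \<longleftrightarrow> fst l = mat_A t" "snd m = (\<not> snd l)"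
          by (simp_all add: \<phi>_def inv_letter_def)
        have "fst m = fst l"
          using eq(1) \<open>fst l \<in> S\<close> \<open>fst m \<in> S\<close> unfolding S_def by (metis insert_iff singletonD)
        then show False
          using lm(3) eq(2) by (simp add: inv_letter_def prod_eq_iff)
      qed
    qed
    then have "reduced_word (map \<phi> w)"
      by (simp add: reduced_word_iff successively_map)
    then show ?thesis
      using trace_ne[of "map \<phi> w"] w by (simp add: eval)
  qed
  have trace_1: "trace (mat 1 :: 'a ^ 2 ^ 2) = 2"
    by (simp add: trace_2 mat_def)
  have no_rel: "eval_word G w \<noteq> \<one>\<^bsub>G\<^esub>" if "w \<in> words S" "reduced_word w" "w \<noteq> []" for w
    using trace[OF that] trace_1 by (auto simp: G_simps)
  define H where "H = group_AB v t"
  have H: "H = G\<lparr>carrier := generate G S\<rparr>"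
    by (simp add: H_def group_AB_def G_def S_def)
  have sub: "subgroup (generate G S) G"
    using S by (rule G.generate_is_subgroup)
  then have group_H: "group H"
    unfolding H using subgroup.subgroup_is_group G.group_axioms by blast
  have H_carrier: "g \<in> carrier G" if "g \<in> carrier H" for g
    using that subgroup.mem_carrier[OF sub] by (simp add: H)
  have free: "free_basis H S"
    unfolding H using G.free_basis_generate[OF S no_rel] by blast
  \<comment> \<open>Write \<open>g\<close> as the value of a reduced word; a nonzero fixed vector
    forces trace 2, so the word is empty.\<close>
  have fixed: "g = mat 1" if g: "g \<in> carrier H" and x: "g *v x = x" "x \<noteq> 0" for g x
  proof -
    obtain w where w: "w \<in> words S" "reduced_word w" "g = eval_word G w"
      using g G.generate_eq_reduced_words[OF S] by (auto simp: H)
    have "trace g = 2"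
      using H_carrier[OF g] x by (intro fixed_vector_trace) (auto simp: G_def)
    then have "w = []"
      using trace[OF w(1,2)] w(3) by auto
    then show ?thesis
      by (simp add: w(3) G_simps)
  qed
  \<comment> \<open>One argument for all three kinds of sets: avoiding 0 and being invariant under
    the special linear group is enough.\<close>
  have acts: "acts_without_fixed_points H (*v) E"
    if "0 \<notin> E" and E: "\<And>g x. g \<in> carrier G \<Longrightarrow> x \<in> E \<Longrightarrow> g *v x \<in> E" for E
  proof -
    have "group_action H E (\<lambda>g. restrict ((*v) g) E)"
      by (rule group_actionI[OF group_H])
         (auto simp: E H_carrier H G_simps matrix_vector_mul_assoc)
    moreover have "stabilizer H (*v) x = {\<one>\<^bsub>H\<^esub>}" if x: "x \<in> E" for x
    proof -
      have "x \<noteq> 0"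
        using x \<open>0 \<notin> E\<close> by blast
      moreover have one: "\<one>\<^bsub>H\<^esub> \<in> carrier H" "\<one>\<^bsub>H\<^esub> = mat 1"
        using subgroup.one_closed[OF sub] by (simp_all add: H G_simps)
      ultimately have "g \<in> carrier H \<and> g *v x = x \<longleftrightarrow> g = \<one>\<^bsub>H\<^esub>" for g
        using fixed[of g x] matrix_vector_mul_lid[of x] by metis
      then show ?thesis
        unfolding stabilizer_def by blast
    qed
    ultimately show ?thesis
      by (simp add: acts_without_fixed_points_def)
  qed
  have norm: "max_norm v (g *v x) = max_norm v x" if "g \<in> carrier G" for g x
    using max_norm_mult[OF v] that by (simp add: G_def)
  have max_norm_0: "max_norm v x = 0 \<longleftrightarrow> x = 0" for x
    using V(1,2)[of "x $ 1"] V(1,2)[of "x $ 2"]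
    by (auto simp: max_norm_def vec_eq_iff forall_2 max_def split: if_splits)
  have nonzero: "g *v x \<noteq> 0" if "g \<in> carrier G" "x \<noteq> 0" for g x
    using norm[OF that(1), of x] that(2) max_norm_0 by metis
  have "acts_without_fixed_points H (*v) (UNIV - {0})"
    by (rule acts) (auto simp: nonzero)
  moreover have "acts_without_fixed_points H (*v) (closed_ball v r - {0})" for r
    by (rule acts) (auto simp: nonzero closed_ball_def norm)
  moreover have "acts_without_fixed_points H (*v) (norm_sphere v r)" if "r > 0" for r
    by (rule acts) (use that max_norm_0[of 0] in \<open>auto simp: norm_sphere_def norm\<close>)
  moreover have "subgroup (carrier H) G"
    using sub by (simp add: H)
  moreover have "mat_A t \<in> carrier G" "mat_B t \<in> carrier G"
    using S unfolding S_def by blast+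
  ultimately show ?thesis
    using s(2) neq free unfolding good_parameter_def H_def S_def G_def s_def by blast
qed

text \<open>\<open>q\<close> has constant term 1, so \<open>q(t\<^sup>2) - 1\<close> is a multiple
  of \<open>t\<close> by an integral element.\<close>

lemma valuation_q_poly:
  fixes t :: "'a::field"
  assumes v: "nonarch_valuation v" and "v t < 1"
  shows "v (poly q_poly (t\<^sup>2) - 1) \<le> v t" "v (poly q_poly (t\<^sup>2)) = 1"
proof -
  note V = nonarch_valuationD[OF v]
  \<comment> \<open>Dividing by \<open>t\<close> gives \<open>t + t ^ 3\<close> or
    \<open>t + t\<close>, depending on \<open>q\<close>.\<close>
  obtain u where u: "v u \<le> 1" "poly q_poly (t\<^sup>2) - 1 = t * u"
  proof (cases "(prime_field :: 'a set) = {0, 1}")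
    case True
    have "v (t + t ^ 3) \<le> 1"
      using V(4)[of t "t ^ 3"] V(6)[of t 3] power_le_one[of "v t" 3] assms(2) V(1) by force
    then show ?thesis
      using True that[of "t + t ^ 3"]
      by (simp add: q_poly_def algebra_simps power2_eq_square power3_eq_cube)
  next
    case False
    have "v (t + t) \<le> 1"
      using V(4)[of t t] assms(2) by simp
    then show ?thesis
      using False that[of "t + t"] by (simp add: q_poly_def algebra_simps power2_eq_square)
  qed
  have "v (t * u) \<le> v t"
    using mult_left_mono[OF u(1), of "v t"] V(1)[of t] by (simp add: V(3))
  then show *: "v (poly q_poly (t\<^sup>2) - 1) \<le> v t"
    by (simp add: u)
  \<comment> \<open>An element at distance less than 1 from 1 has value 1, by the ultrametric
    inequality used in both directions.\<close>
  define s where "s = poly q_poly (t\<^sup>2)"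
  have "v (s - 1) < 1"
    using * assms(2) by (simp add: s_def)
  moreover have "v s \<le> max (v (s - 1)) 1"
    using V(4)[of "s - 1" 1] V(5) by simp
  moreover have "1 \<le> max (v s) (v (s - 1))"
    using V(4)[of s "- (s - 1)"] V(5) by (simp only: V(8)) simp
  ultimately show "v (poly q_poly (t\<^sup>2)) = 1"
    by (simp add: s_def)
qed

lemma ex_good_parameter_eps:
  fixes v :: "'a::field \<Rightarrow> real"
  assumes v: "nonarch_valuation v" and tr: "transc (x :: 'a)"
    and nt: "\<not> trivial_valuation v" and \<epsilon>: "0 < \<epsilon>" "\<epsilon> \<le> 1"
  shows "\<exists>t \<in> integer_ring v. good_parameter v t \<and>
    mat_A t \<in> carrier (SL2_eps v \<epsilon>) \<and> mat_B t \<in> carrier (SL2_eps v \<epsilon>)"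
proof -
  note V = nonarch_valuationD[OF v]
  obtain t where t: "transc t" "v t < \<epsilon>"
    using ex_small_transc[OF v nt tr \<epsilon>(1)] .
  define s where "s = poly q_poly (t\<^sup>2)"
  have t1: "v t < 1"
    using t \<epsilon> by simp
  have s: "v (s - 1) < \<epsilon>" "v s = 1"
    using valuation_q_poly[OF v t1] t(2) by (simp_all add: s_def)
  then have "s \<noteq> 0"
    using V(2)[of s] by auto
  \<comment> \<open>As \<open>s\<close> has value 1, its inverse is exactly as close to 1 as
    \<open>s\<close> is.\<close>
  then have "inverse s - 1 = - (inverse s * (s - 1))"
    by (simp add: field_simps)
  then have s': "v (inverse s - 1) < \<epsilon>"
    using s by (simp add: V(3,7,8))
  have good: "good_parameter v t"
    using good_parameter_transc[OF v t(1)] t1 s by (simp add: s_def)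
  have A: "mat_A t = mat2 s t 0 (inverse s)" and B: "mat_B t = mat2 s 0 ((inverse s)\<^sup>2 * t) (inverse s)"
    by (simp_all add: mat_AB_eq_AB_letter s_def)
  have "v ((inverse s)\<^sup>2 * t) < \<epsilon>" "v 0 < \<epsilon>"
    using t s \<epsilon> V(2)[of 0] by (simp_all add: V(3,6,7))
  moreover have "mat_A t \<in> carrier (SL2 (integer_ring v))" "mat_B t \<in> carrier (SL2 (integer_ring v))"
    using good by (simp_all add: good_parameter_def del: SL2_simps)
  ultimately have "mat_A t \<in> carrier (SL2_eps v \<epsilon>)" "mat_B t \<in> carrier (SL2_eps v \<epsilon>)"
    using s s' t(2) unfolding SL2_eps_def
    by (simp_all add: forall_2 A B del: SL2_simps)
  then show ?thesis
    using good t1 by (intro bexI[of _ t]) (auto simp: integer_ring_def)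
qed

theorem theorem4p18:
  fixes v :: "'a::field \<Rightarrow> real"
  assumes "nonarch_valuation v"
    and "transcendental_extension (prime_field :: 'a set)"
  shows "(\<exists>t \<in> integer_ring v. good_parameter v t) \<and>
    (\<not> trivial_valuation v \<longrightarrow>
      (\<forall>\<epsilon>. 0 < \<epsilon> \<and> \<epsilon> \<le> 1 \<longrightarrow>
        (\<exists>t \<in> integer_ring v. good_parameter v t \<and>
           mat_A t \<in> carrier (SL2_eps v \<epsilon>) \<and> mat_B t \<in> carrier (SL2_eps v \<epsilon>))))"
proof -
  obtain x :: 'a where x: "transc x"
    using assms(2) by (auto simp: transcendental_extension_def)
  have eps: "\<exists>t \<in> integer_ring v. good_parameter v t \<and>
      mat_A t \<in> carrier (SL2_eps v \<epsilon>) \<and> mat_B t \<in> carrier (SL2_eps v \<epsilon>)"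
    if "\<not> trivial_valuation v" "0 < \<epsilon>" "\<epsilon> \<le> 1" for \<epsilon>
    using ex_good_parameter_eps[OF assms(1) x that] .
  have "\<exists>t \<in> integer_ring v. good_parameter v t"
  proof (cases "trivial_valuation v")
    \<comment> \<open>For the trivial valuation every element is integral and every nonzero element
      has value 1, so \<open>x\<close> itself serves as the parameter.\<close>
    case True
    then have v: "v y \<le> 1" for y
      using nonarch_valuationD(2)[OF assms(1), of y]
      by (cases "y = 0") (auto simp: trivial_valuation_def)
    have "poly q_poly (x\<^sup>2) \<noteq> 0"
      using q_specialisation[OF x] by blast
    then have "good_parameter v x"
      using True v by (intro good_parameter_transc[OF assms(1) x]) (auto simp: trivial_valuation_def)
    then show ?thesis
      using v by (auto simp: integer_ring_def)
  next
    case False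
    then show ?thesis
      using eps[of 1] by auto
  qed
  then show ?thesis
    using eps by blast
qed

end
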